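(* Let $G$ be a just infinite profinite group. (i) Let $n$ be an integer. Then $G$ has finitely many open subgroups of index $n$. (ii) Let $H$ be an infinite profinite group such that every finite image of $H$ is isomorphic to some image of $G$. Then $G\cong H$.
   Context: All subgroups are closed, homomorphisms are continuous; an image of a profinite group is a quotient by a closed normal subgroup, and isomorphisms are as topological groups. A profinite group is just infinite if it is infinite and every non-trivial normal subgroup has finite index. *)

theory Defs
  imports "HOL-Analysis.Analysis" "HOL-Algebra.Algebra"
begin

locale topological_group = Group.group G
  for G :: "('a, 'm) monoid_scheme" (structure) +
  fixes T :: "'a topology"
  assumes topspace_eq: "topspace T = carrier G"
    and continuous_mult: "continuous_map (prod_topology T T) T (\<lambda>(x, y). x \<otimes> y)"
    and continuous_inv: "continuous_map T T (\<lambda>x. inv x)"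

locale profinite_group = topological_group +
  assumes compact: "compact_space T"
    and Hausdorff: "Hausdorff_space T"
    and totally_disconnected: "\<And>x. x \<in> topspace T \<Longrightarrow> connected_component_of_set T x = {x}"

text \<open>Subgroups of profinite groups are closed by convention, so only the closed normal
  subgroups are required to have finite index; an abstract normal subgroup is not considered.\<close>

locale just_infinite_profinite_group = profinite_group +
  assumes infinite_carrier: "infinite (carrier G)"
    and just_infinite:
      "\<And>N. \<lbrakk>N \<lhd> G; closedin T N; N \<noteq> {\<one>}\<rbrakk> \<Longrightarrow> finite (rcosets N)"

text \<open>Finiteness is stated separately because the cardinality of an infinite set is \<open>0\<close>.\<close>

definition has_index :: "('a, 'm) monoid_scheme \<Rightarrow> 'a set \<Rightarrow> int \<Rightarrow> bool" where
  "has_index G U n \<longleftrightarrow> finite (rcosets\<^bsub>G\<^esub> U) \<and> int (card (rcosets\<^bsub>G\<^esub> U)) = n"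

definition quotient_topology ::
    "('a, 'm) monoid_scheme \<Rightarrow> 'a topology \<Rightarrow> 'a set \<Rightarrow> 'a set topology" where
  "quotient_topology G T N =
     topology (\<lambda>V. V \<subseteq> carrier (G Mod N) \<and> openin T {x \<in> carrier G. N #>\<^bsub>G\<^esub> x \<in> V})"

definition topologically_isomorphic ::
    "('a, 'm) monoid_scheme \<Rightarrow> 'a topology \<Rightarrow> ('b, 'n) monoid_scheme \<Rightarrow> 'b topology \<Rightarrow> bool" where
  "topologically_isomorphic G T H S \<longleftrightarrow> (\<exists>f. f \<in> iso G H \<and> homeomorphic_map T S f)"

context topological_group
begin

lemma openin_quotient_topology:
  "openin (quotient_topology G T N) V \<longleftrightarrow>
     V \<subseteq> carrier (G Mod N) \<and> openin T {x \<in> carrier G. N #> x \<in> V}"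
proof -
  have "istopology (\<lambda>V. V \<subseteq> carrier (G Mod N) \<and> openin T {x \<in> carrier G. N #> x \<in> V})"
    (is "istopology ?P")
    unfolding istopology_def
  proof (intro conjI allI impI)
    fix V W assume "?P V" "?P W"
    moreover have "{x \<in> carrier G. N #> x \<in> V \<inter> W} =
        {x \<in> carrier G. N #> x \<in> V} \<inter> {x \<in> carrier G. N #> x \<in> W}"
      by auto
    ultimately show "V \<inter> W \<subseteq> carrier (G Mod N)"
      and "openin T {x \<in> carrier G. N #> x \<in> V \<inter> W}"
      by auto
  next
    fix \<K> assume K: "\<forall>V\<in>\<K>. ?P V"
    then show "\<Union>\<K> \<subseteq> carrier (G Mod N)"
      by blast
    have "{x \<in> carrier G. N #> x \<in> \<Union>\<K>} = (\<Union>V\<in>\<K>. {x \<in> carrier G. N #> x \<in> V})"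
      by auto
    with K show "openin T {x \<in> carrier G. N #> x \<in> \<Union>\<K>}"
      by auto
  qed
  then show ?thesis
    by (simp add: quotient_topology_def topology_inverse')
qed

lemma topspace_quotient_topology: "topspace (quotient_topology G T N) = carrier (G Mod N)"
proof -
  have "{x \<in> carrier G. N #> x \<in> carrier (G Mod N)} = topspace T"
    by (auto simp: carrier_FactGroup topspace_eq)
  then have "openin (quotient_topology G T N) (carrier (G Mod N))"
    by (simp add: openin_quotient_topology)
  then show ?thesis
    by (meson openin_quotient_topology openin_subset openin_topspace subset_antisym)
qed

lemma quotient_map_quotient_topology:
  "quotient_map T (quotient_topology G T N) (\<lambda>x. N #> x)"
  unfolding quotient_map_def
  by (auto simp: topspace_quotient_topology topspace_eq carrier_FactGroup openin_quotient_topology)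

end

end

theory Submission
  imports Defs
begin

text \<open>
  Let \<open>G\<close> be just infinite.  The heart of the proof is that only finitely many open normal
  subgroups of \<open>G\<close> lie outside a given neighbourhood \<open>V\<close> of the identity
  (\<open>finite_open_normal_not_in_neighbourhood\<close>).  It rests on two facts.

  First, a strictly decreasing sequence of closed normal subgroups is eventually contained in \<open>V\<close>:
  its intersection has infinite index, hence is trivial, and \<open>G\<close> is compact.  So any nonempty
  family of closed normal subgroups outside \<open>V\<close> has a minimal member.  Second, an open normal
  subgroup \<open>N\<close> has only finitely many maximal members among the open normal subgroups of \<open>G\<close>
  properly inside it (\<open>finite_maximal_normal_below\<close>).  If infinitely many open normal subgroups
  were outside \<open>V\<close>, there would be a minimal open normal \<open>N\<close> containing infinitely many of them;
  all but \<open>N\<close> itself lie in one of the finitely many maximal subgroups below \<open>N\<close>, each of which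
  contains only finitely many of them, a contradiction.

  Taking for \<open>V\<close> an open normal subgroup of index greater than \<open>m\<close> shows that there are finitely
  many open normal subgroups of index at most \<open>m\<close>.  A subgroup of index \<open>n\<close> contains its normal
  core, of index at most \<open>n ^ n\<close>, so there are finitely many open subgroups of index \<open>n\<close>.

  For the second part, \<open>G\<close> has, for each open normal subgroup \<open>N\<close> of \<open>H\<close>, a continuous epimorphism
  onto \<open>H Mod N\<close>, and by the first part only finitely many.  The functions from \<open>G\<close> to \<open>H\<close> that
  lift one of them form a nonempty closed subset of the compact product \<open>H ^ G\<close>, closed because it
  is a finite union of products of cosets.  These sets are directed, so by compactness some
  function lies in all of them.  It is a continuous epimorphism of \<open>G\<close> onto the infinite group
  \<open>H\<close>; its kernel has infinite index, hence is trivial, and a continuous bijection from a compact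
  space onto a Hausdorff space is a homeomorphism.
\<close>

section \<open>Cosets\<close>

lemma finite_image_if_determined:
  assumes "finite (f ` A)" and "\<And>x y. \<lbrakk>x \<in> A; y \<in> A; f x = f y\<rbrakk> \<Longrightarrow> g x = g y"
  shows "finite (g ` A) \<and> card (g ` A) \<le> card (f ` A)"
proof -
  have sub: "g ` A \<subseteq> (\<lambda>c. g (inv_into A f c)) ` f ` A"
  proof
    fix z assume "z \<in> g ` A"
    then obtain x where x: "x \<in> A" "z = g x"
      by blast
    then have "g x = g (inv_into A f (f x))"
      by (intro assms(2)) (auto simp: inv_into_into f_inv_into_f)
    then show "z \<in> (\<lambda>c. g (inv_into A f c)) ` f ` A"
      using x by blast
  qed
  have fin: "finite ((\<lambda>c. g (inv_into A f c)) ` f ` A)"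
    using assms(1) by simp
  have "card (g ` A) \<le> card ((\<lambda>c. g (inv_into A f c)) ` f ` A)"
    using fin sub by (rule card_mono)
  also have "\<dots> \<le> card (f ` A)"
    using assms(1) by (rule card_image_le)
  finally show ?thesis
    using finite_subset[OF sub fin] by (rule conjI[rotated])
qed

context group
begin

lemma rcosets_eq_image: "rcosets N = (\<lambda>x. N #> x) ` carrier G"
  by (auto simp: RCOSETS_def)

lemma mem_rcos_iff:
  assumes "subgroup N G" "x \<in> carrier G" "y \<in> carrier G"
  shows "x \<in> N #> y \<longleftrightarrow> x \<otimes> inv y \<in> N"
  by (rule subgroup.rcos_module[OF assms(1) is_group assms(3,2)])

lemma rcos_eq_iff:
  assumes "subgroup N G" "x \<in> carrier G" "y \<in> carrier G"
  shows "N #> x = N #> y \<longleftrightarrow> x \<otimes> inv y \<in> N"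
proof
  assume "N #> x = N #> y"
  then show "x \<otimes> inv y \<in> N"
    using rcos_self[OF assms(2,1)] mem_rcos_iff[OF assms] by simp
next
  assume "x \<otimes> inv y \<in> N"
  then have "x \<in> N #> y"
    using mem_rcos_iff[OF assms] by simp
  from repr_independence[OF this assms(3,1)] show "N #> x = N #> y"
    by (rule sym)
qed

lemma rcos_fibre:
  assumes "subgroup N G" "y \<in> carrier G"
  shows "{x \<in> carrier G. N #> x = N #> y} = N #> y"
proof -
  have "N #> x = N #> y \<longleftrightarrow> x \<in> N #> y" if "x \<in> carrier G" for x
    using that assms by (simp add: mem_rcos_iff rcos_eq_iff)
  moreover have "N #> y \<subseteq> carrier G"
    using assms by (intro r_coset_subset_G subgroup.subset)
  ultimately show ?thesis
    by blast
qed

lemma finite_rcosets_mono: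
  assumes "subgroup B G" "subgroup U G" "B \<subseteq> U" "finite (rcosets B)"
  shows "finite (rcosets U) \<and> card (rcosets U) \<le> card (rcosets B)"
  unfolding rcosets_eq_image
proof (rule finite_image_if_determined)
  show "finite ((\<lambda>x. B #> x) ` carrier G)"
    using assms(4) by (simp add: rcosets_eq_image)
  show "U #> x = U #> y" if "x \<in> carrier G" "y \<in> carrier G" "B #> x = B #> y" for x y
  proof -
    have "x \<otimes> inv y \<in> U"
      using that rcos_eq_iff[OF assms(1)] assms(3) by auto
    then show ?thesis
      using that rcos_eq_iff[OF assms(2)] by simp
  qed
qed

lemma finite_supergroups:
  assumes "subgroup B G" "finite (rcosets B)"
  shows "finite {U. subgroup U G \<and> B \<subseteq> U}"
proof (rule finite_subset)
  show "{U. subgroup U G \<and> B \<subseteq> U} \<subseteq> Union ` Pow (rcosets B)"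
  proof
    fix U assume "U \<in> {U. subgroup U G \<and> B \<subseteq> U}"
    then have U: "subgroup U G" "B \<subseteq> U" by auto
    have "(\<Union>x\<in>U. B #> x) = U"
    proof
      show "(\<Union>x\<in>U. B #> x) \<subseteq> U"
        using U by (auto simp: r_coset_def subgroup.m_closed subsetD)
      show "U \<subseteq> (\<Union>x\<in>U. B #> x)"
        using rcos_self[OF subgroup.mem_carrier[OF U(1)] assms(1)] by blast
    qed
    moreover have "(\<lambda>x. B #> x) ` U \<in> Pow (rcosets B)"
      using subgroup.subset[OF U(1)] by (auto simp: rcosets_eq_image)
    ultimately show "U \<in> Union ` Pow (rcosets B)"
      by blast
  qed
qed (use assms in simp)

lemma normal_Inter:
  assumes "\<A> \<noteq> {}" "\<And>N. N \<in> \<A> \<Longrightarrow> N \<lhd> G"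
  shows "\<Inter>\<A> \<lhd> G"
proof (rule normal_invI)
  show "subgroup (\<Inter>\<A>) G"
    using assms by (simp add: normal_imp_subgroup subgroups_Inter)
  show "x \<otimes> h \<otimes> inv x \<in> \<Inter>\<A>" if "x \<in> carrier G" "h \<in> \<Inter>\<A>" for x h
    using that assms(2) normal_invE(2) by auto
qed

text \<open>The normal core of a subgroup: the intersection of its conjugates.\<close>

definition core :: "'a set \<Rightarrow> 'a set" where
  "core U = {g \<in> carrier G. \<forall>h\<in>carrier G. h \<otimes> g \<otimes> inv h \<in> U}"

lemma core_subset: "core U \<subseteq> U"
proof
  fix g assume "g \<in> core U"
  then have "g \<in> carrier G" "\<one> \<otimes> g \<otimes> inv \<one> \<in> U"
    unfolding core_def by blast+
  then show "g \<in> U" by simp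
qed

lemma core_normal:
  assumes "subgroup U G"
  shows "core U \<lhd> G"
proof (rule normal_invI)
  show "subgroup (core U) G"
  proof (rule subgroupI)
    show "core U \<subseteq> carrier G" by (auto simp: core_def)
    have "\<one> \<in> core U"
      using assms by (auto simp: core_def subgroup.one_closed)
    then show "core U \<noteq> {}" by blast
  next
    fix a assume a: "a \<in> core U"
    have "h \<otimes> inv a \<otimes> inv h \<in> U" if h: "h \<in> carrier G" for h
    proof -
      have "inv (h \<otimes> a \<otimes> inv h) \<in> U"
        using a h assms by (auto simp: core_def intro: subgroup.m_inv_closed)
      then show ?thesis
        using a h by (simp add: core_def inv_mult_group m_assoc)
    qed
    then show "inv a \<in> core U"
      using a by (auto simp: core_def)
  next
    fix a b assume ab: "a \<in> core U" "b \<in> core U"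
    have "h \<otimes> (a \<otimes> b) \<otimes> inv h \<in> U" if h: "h \<in> carrier G" for h
    proof -
      have "(h \<otimes> a \<otimes> inv h) \<otimes> (h \<otimes> b \<otimes> inv h) \<in> U"
        using ab h assms by (auto simp: core_def intro: subgroup.m_closed)
      moreover have "(h \<otimes> a \<otimes> inv h) \<otimes> (h \<otimes> b \<otimes> inv h) = h \<otimes> (a \<otimes> b) \<otimes> inv h"
        using ab h by (simp add: core_def m_assoc inv_solve_left')
      ultimately show ?thesis by simp
    qed
    then show "a \<otimes> b \<in> core U"
      using ab by (auto simp: core_def)
  qed
next
  fix x g assume x: "x \<in> carrier G" and g: "g \<in> core U"
  have "h \<otimes> (x \<otimes> g \<otimes> inv x) \<otimes> inv h \<in> U" if h: "h \<in> carrier G" for h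
  proof -
    have "(h \<otimes> x) \<otimes> g \<otimes> inv (h \<otimes> x) \<in> U"
      using g x h by (auto simp: core_def)
    then show ?thesis
      using g x h by (simp add: core_def inv_mult_group m_assoc)
  qed
  then show "x \<otimes> g \<otimes> inv x \<in> core U"
    using g x by (auto simp: core_def)
qed

text \<open>The core is the kernel of the action on the right cosets of \<open>U\<close>, and there are at most
  \<open>n ^ n\<close> maps from a set of \<open>n\<close> cosets to itself.\<close>

lemma card_rcosets_core:
  assumes U: "subgroup U G" and fin: "finite (rcosets U)"
  shows "finite (rcosets (core U)) \<and>
    card (rcosets (core U)) \<le> card (rcosets U) ^ card (rcosets U)"
proof -
  define act where "act x = (\<lambda>c\<in>rcosets U. c #> x)" for x
  have act: "act ` carrier G \<subseteq> rcosets U \<rightarrow>\<^sub>E rcosets U"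
    using subgroup.subset[OF U]
    by (auto simp: act_def rcosets_eq_image coset_mult_assoc)
  have finE: "finite (rcosets U \<rightarrow>\<^sub>E rcosets U)"
    using fin by (simp add: finite_PiE)
  have eq: "core U #> x = core U #> y"
    if x: "x \<in> carrier G" and y: "y \<in> carrier G" and eq: "act x = act y" for x y
  proof -
    have "h \<otimes> (x \<otimes> inv y) \<otimes> inv h \<in> U" if h: "h \<in> carrier G" for h
    proof -
      have "(U #> h) #> x = (U #> h) #> y"
        using fun_cong[OF eq, of "U #> h"] h by (simp add: act_def rcosets_eq_image)
      then have "U #> (h \<otimes> x) = U #> (h \<otimes> y)"
        using subgroup.subset[OF U] h x y by (simp add: coset_mult_assoc)
      then have "(h \<otimes> x) \<otimes> inv (h \<otimes> y) \<in> U"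
        using U h x y by (simp add: rcos_eq_iff)
      then show ?thesis
        using h x y by (simp add: inv_mult_group m_assoc)
    qed
    then have "x \<otimes> inv y \<in> core U"
      using x y by (auto simp: core_def)
    then show ?thesis
      using x y core_normal[OF U] by (simp add: rcos_eq_iff normal_imp_subgroup)
  qed
  have fact: "finite (act ` carrier G)"
    using act finE finite_subset by blast
  have "finite (rcosets (core U)) \<and> card (rcosets (core U)) \<le> card (act ` carrier G)"
    unfolding rcosets_eq_image by (rule finite_image_if_determined[OF fact eq])
  moreover have "card (act ` carrier G) \<le> card (rcosets U) ^ card (rcosets U)"
    using card_mono[OF finE act] fin by (simp add: card_PiE)
  ultimately show ?thesis by (meson le_trans)
qed

end

section \<open>Open subgroups of topological and profinite groups\<close>

context topological_group
begin

lemma continuous_map_mult [continuous_intros]: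
  assumes "continuous_map Z T f" "continuous_map Z T g"
  shows "continuous_map Z T (\<lambda>x. f x \<otimes> g x)"
  using continuous_map_compose[OF continuous_map_pairedI[OF assms] continuous_mult]
  by (simp add: o_def)

lemma continuous_map_inverse [continuous_intros]:
  "continuous_map Z T f \<Longrightarrow> continuous_map Z T (\<lambda>x. inv (f x))"
  using continuous_map_compose[OF _ continuous_inv] by (simp add: o_def)

lemma rcos_eq_preimage:
  assumes "subgroup N G" "x \<in> carrier G"
  shows "N #> x = {y \<in> topspace T. y \<otimes> inv x \<in> N}"
  using assms mem_rcos_iff[OF assms(1) _ assms(2)] r_coset_subset_G[OF subgroup.subset[OF assms(1)] assms(2)]
  by (auto simp: topspace_eq)

lemma continuous_map_right_mult:
  assumes "x \<in> carrier G"
  shows "continuous_map T T (\<lambda>y. y \<otimes> x)"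
  by (intro continuous_intros) (use assms in \<open>auto simp: topspace_eq\<close>)

lemma openin_rcos:
  assumes "subgroup N G" "openin T N" "x \<in> carrier G"
  shows "openin T (N #> x)"
  using assms openin_continuous_map_preimage[OF continuous_map_right_mult]
  by (simp add: rcos_eq_preimage)

lemma closedin_rcos:
  assumes "subgroup N G" "closedin T N" "x \<in> carrier G"
  shows "closedin T (N #> x)"
  using assms closedin_continuous_map_preimage[OF continuous_map_right_mult]
  by (simp add: rcos_eq_preimage)

lemma complement_eq_Union_rcosets:
  assumes "subgroup N G"
  shows "topspace T - N = \<Union>(rcosets N - {N})"
proof -
  have "N \<in> rcosets N"
    using assms by (simp add: is_group subgroup.subgroup_in_rcosets)
  then have "\<Union>(rcosets N - {N}) = \<Union>(rcosets N) - N"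
    using rcos_disjoint[OF assms] by (auto simp: pairwise_def disjnt_def)
  then show ?thesis
    using rcosets_part_G[OF assms] by (simp add: topspace_eq)
qed

lemma open_subgroup_closed:
  assumes "subgroup N G" "openin T N"
  shows "closedin T N"
proof -
  have "openin T (\<Union>(rcosets N - {N}))"
    using openin_rcos[OF assms] by (intro openin_Union) (auto simp: rcosets_eq_image)
  then show ?thesis
    using assms by (simp add: closedin_def openin_subset complement_eq_Union_rcosets)
qed

lemma closed_finite_index_open:
  assumes "subgroup N G" "closedin T N" "finite (rcosets N)"
  shows "openin T N"
proof -
  have "closedin T (\<Union>(rcosets N - {N}))"
    using closedin_rcos[OF assms(1,2)] assms(3)
    by (intro closedin_Union) (auto simp: rcosets_eq_image)
  then show ?thesis
    using assms by (simp add: openin_closedin_eq closedin_subset complement_eq_Union_rcosets)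
qed

lemma open_supergroup:
  assumes "subgroup B G" "openin T B" "subgroup U G" "B \<subseteq> U"
  shows "openin T U"
proof -
  have "U = (\<Union>x\<in>U. B #> x)"
  proof
    show "(\<Union>x\<in>U. B #> x) \<subseteq> U"
      using assms by (auto simp: r_coset_def subgroup.m_closed subsetD)
    show "U \<subseteq> (\<Union>x\<in>U. B #> x)"
      using rcos_self[OF subgroup.mem_carrier[OF assms(3)] assms(1)] by blast
  qed
  moreover have "openin T (\<Union>x\<in>U. B #> x)"
    using openin_rcos[OF assms(1,2)] subgroup.mem_carrier[OF assms(3)] by blast
  ultimately show ?thesis by simp
qed

end

context profinite_group
begin

lemma one_in_topspace: "\<one> \<in> topspace T"
  by (simp add: topspace_eq)

text \<open>The complement is the projection of a closed set along the compact second factor, hence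
  closed.\<close>

lemma openin_Ball_compact:
  assumes "continuous_map (prod_topology T T) T f" "closedin T C" "openin T V"
  shows "openin T {g \<in> topspace T. \<forall>c\<in>C. f (g, c) \<in> V}"
proof -
  let ?P = "prod_topology T T"
  let ?Z = "{z \<in> topspace ?P. snd z \<in> C} \<inter> {z \<in> topspace ?P. f z \<in> topspace T - V}"
  have "closedin ?P ?Z"
    using assms
    by (intro closedin_Int closedin_continuous_map_preimage[OF continuous_map_snd]
        closedin_continuous_map_preimage[OF assms(1)]) auto
  then have "closedin T (fst ` ?Z)"
    using closed_map_fst[OF compact] by (auto simp: closed_map_def)
  moreover have "fst ` ?Z = {g \<in> topspace T. \<exists>c\<in>C. f (g, c) \<notin> V}"
  proof (intro subset_antisym subsetI)
    fix g assume "g \<in> {g \<in> topspace T. \<exists>c\<in>C. f (g, c) \<notin> V}"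
    then obtain c where "g \<in> topspace T" "c \<in> C" "f (g, c) \<notin> V"
      by blast
    moreover have "c \<in> topspace T"
      using \<open>c \<in> C\<close> closedin_subset[OF assms(2)] by blast
    moreover have "f (g, c) \<in> topspace T"
      using continuous_map_funspace[OF assms(1)] \<open>g \<in> topspace T\<close> \<open>c \<in> topspace T\<close> by auto
    ultimately have "(g, c) \<in> ?Z" by simp
    then show "g \<in> fst ` ?Z" by (rule rev_image_eqI) simp
  qed auto
  ultimately have "closedin T {g \<in> topspace T. \<exists>c\<in>C. f (g, c) \<notin> V}"
    by simp
  then have "openin T (topspace T - {g \<in> topspace T. \<exists>c\<in>C. f (g, c) \<notin> V})"
    by blast
  also have "topspace T - {g \<in> topspace T. \<exists>c\<in>C. f (g, c) \<notin> V} =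
      {g \<in> topspace T. \<forall>c\<in>C. f (g, c) \<in> V}"
    by blast
  finally show ?thesis .
qed

lemma open_subgroup_finite_index:
  assumes "subgroup N G" "openin T N"
  shows "finite (rcosets N)"
proof -
  have "\<exists>\<F>. finite \<F> \<and> \<F> \<subseteq> rcosets N \<and> topspace T \<subseteq> \<Union>\<F>"
    using compact openin_rcos[OF assms] rcosets_part_G[OF assms(1)]
    unfolding compact_space_alt by (force simp: rcosets_eq_image topspace_eq)
  then obtain \<F> where F: "finite \<F>" "\<F> \<subseteq> rcosets N" "carrier G \<subseteq> \<Union>\<F>"
    by (auto simp: topspace_eq)
  have "rcosets N \<subseteq> \<F>"
  proof
    fix c assume c: "c \<in> rcosets N"
    then obtain x where "x \<in> c" "x \<in> carrier G"
      using rcos_self assms(1) by (auto simp: rcosets_eq_image)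
    then obtain d where "d \<in> \<F>" "x \<in> d"
      using F by blast
    then show "c \<in> \<F>"
      using rcos_disjoint[OF assms(1)] c F(2) \<open>x \<in> c\<close>
      by (metis disjnt_iff pairwiseD subsetD)
  qed
  then show ?thesis
    using F(1) finite_subset by blast
qed

lemma open_core:
  assumes "subgroup U G" "openin T U"
  shows "openin T (core U)"
proof -
  have "continuous_map (prod_topology T T) T (\<lambda>z. snd z \<otimes> fst z \<otimes> inv (snd z))"
    by (intro continuous_intros continuous_map_fst continuous_map_snd)
  from openin_Ball_compact[OF this closedin_topspace assms(2)]
  show ?thesis by (simp add: core_def topspace_eq)
qed

text \<open>In a compact Hausdorff space connected components coincide with quasi-components, so the
  identity is separated by clopen sets from any disjoint compact set.\<close>

lemma clopen_neighbourhood_of_one: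
  assumes "openin T V" "\<one> \<in> V"
  obtains C where "openin T C" "closedin T C" "\<one> \<in> C" "C \<subseteq> V"
proof -
  have "quasi_component_of T \<one> = connected_component_of T \<one>"
    by (rule quasi_eq_connected_component_of) (simp add: compact Hausdorff)
  then have "quasi_component_of_set T \<one> = {\<one>}"
    using totally_disconnected[OF one_in_topspace] by simp
  then have q: "{\<one>} \<in> quasi_components_of T"
    unfolding quasi_components_of_def using imageI[OF one_in_topspace] by metis
  have "compactin T (topspace T - V)"
    using assms compact by (intro closedin_compact_space) auto
  then have "separated_between T {\<one>} (topspace T - V)"
    using separated_between_quasi_component_compact[OF q] assms by simp
  then obtain A B where "openin T A" "openin T B" "A \<union> B = topspace T" "disjnt A B"
      "{\<one>} \<subseteq> A" "topspace T - V \<subseteq> B"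
    by (meson separated_between_def)
  moreover from this have "A = topspace T - B" "A \<subseteq> V"
    by (auto simp: disjnt_def dest: openin_subset)
  ultimately show ?thesis
    using that[of A] by (metis closedin_diff closedin_topspace insert_subset)
qed

text \<open>A clopen neighbourhood \<open>C\<close> of the identity contains its own stabiliser under left
  translation, and this stabiliser is open because \<open>C\<close> is open and compact.\<close>

theorem open_normal_subgroup_in_neighbourhood:
  assumes "openin T V" "\<one> \<in> V"
  obtains N where "N \<lhd> G" "openin T N" "N \<subseteq> V"
proof -
  obtain C where C: "openin T C" "closedin T C" "\<one> \<in> C" "C \<subseteq> V"
    using clopen_neighbourhood_of_one assms by blast
  have CG: "C \<subseteq> carrier G"
    using openin_subset[OF C(1)] topspace_eq by simp
  define L where "L = {g \<in> carrier G. \<forall>c\<in>C. g \<otimes> c \<in> C}"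
  define K where "K = L \<inter> {g \<in> carrier G. inv g \<in> L}"
  have oL: "openin T L"
    using openin_Ball_compact[OF continuous_mult C(2,1)] by (simp add: L_def topspace_eq)
  have "openin T K"
    using openin_continuous_map_preimage[OF continuous_inv oL] oL by (simp add: K_def topspace_eq openin_Int)
  moreover have "subgroup K G"
  proof (rule subgroupI)
    show "K \<subseteq> carrier G" by (auto simp: K_def)
    have "\<one> \<in> K" using CG by (auto simp: K_def L_def)
    then show "K \<noteq> {}" by blast
    show "inv a \<in> K" if "a \<in> K" for a using that by (auto simp: K_def)
    have "a \<otimes> b \<in> L" if "a \<in> L" "b \<in> L" for a b
      using that CG by (auto simp: L_def m_assoc subsetD)
    then show "a \<otimes> b \<in> K" if "a \<in> K" "b \<in> K" for a b
      using that by (auto simp: K_def inv_mult_group)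
  qed
  moreover have "K \<subseteq> C"
    using C(3) by (force simp: K_def L_def)
  ultimately show ?thesis
    using that[of "core K"] core_subset[of K] core_normal[of K] open_core[of K] C(4) by blast
qed

lemma open_coset_in_neighbourhood:
  assumes "openin T V" "x \<in> V"
  obtains N where "N \<lhd> G" "openin T N" "N #> x \<subseteq> V"
proof -
  have x: "x \<in> carrier G"
    using assms openin_subset topspace_eq by blast
  let ?W = "{y \<in> topspace T. y \<otimes> x \<in> V}"
  have "openin T ?W"
    using openin_continuous_map_preimage[OF continuous_map_right_mult[OF x] assms(1)] .
  moreover have "\<one> \<in> ?W"
    using x assms by (simp add: topspace_eq)
  ultimately obtain N where "N \<lhd> G" "openin T N" "N \<subseteq> ?W"
    by (rule open_normal_subgroup_in_neighbourhood)
  then show ?thesis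
    using that[of N] by (auto simp: r_coset_def)
qed

lemma eq_if_congruent_mod_open_normal:
  assumes "x \<in> carrier G" "y \<in> carrier G"
    and "\<And>N. \<lbrakk>N \<lhd> G; openin T N\<rbrakk> \<Longrightarrow> x \<otimes> inv y \<in> N"
  shows "x = y"
proof (rule ccontr)
  assume "x \<noteq> y"
  then have "\<one> \<noteq> x \<otimes> inv y"
    using assms(1,2) inv_equality[of x "inv y"] by auto
  moreover have "closedin T {x \<otimes> inv y}"
    using assms(1,2) Hausdorff by (simp add: closedin_Hausdorff_singleton topspace_eq)
  ultimately obtain N where "N \<lhd> G" "openin T N" "N \<subseteq> topspace T - {x \<otimes> inv y}"
    using open_normal_subgroup_in_neighbourhood[of "topspace T - {x \<otimes> inv y}"] one_in_topspace
    by blast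
  then show False
    using assms(3) by blast
qed

text \<open>An open normal subgroup that avoids all quotients of distinct elements of a finite set \<open>F\<close>
  separates the points of \<open>F\<close>.\<close>

lemma infinite_imp_large_index:
  assumes "infinite (carrier G)"
  obtains K where "K \<lhd> G" "openin T K" "m < card (rcosets K)"
proof -
  obtain F where F: "F \<subseteq> carrier G" "finite F" "card F = Suc m"
    using infinite_arbitrarily_large[OF assms, of "Suc m"] by auto
  define D where "D = (\<lambda>(x, y). x \<otimes> inv y) ` {(x, y) \<in> F \<times> F. x \<noteq> y}"
  have "finite D"
    unfolding D_def by (rule finite_imageI, rule finite_subset[of _ "F \<times> F"]) (use F(2) in auto)
  moreover have "D \<subseteq> topspace T"
    using F(1) by (auto simp: D_def topspace_eq subset_iff)
  ultimately have "closedin T D"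
    using Hausdorff by (simp add: closedin_Hausdorff_finite)
  moreover have "\<one> \<notin> D"
  proof
    assume "\<one> \<in> D"
    then obtain x y where xy: "x \<in> F" "y \<in> F" "x \<noteq> y" "x \<otimes> inv y = \<one>"
      by (auto simp: D_def)
    then show False
      using F(1) inv_equality[of x "inv y"] by (auto simp: subset_iff)
  qed
  ultimately obtain K where K: "K \<lhd> G" "openin T K" "K \<subseteq> topspace T - D"
    using open_normal_subgroup_in_neighbourhood[of "topspace T - D"] one_in_topspace by blast
  have sK: "subgroup K G"
    using K(1) by (rule normal_imp_subgroup)
  have "inj_on (\<lambda>x. K #> x) F"
  proof (rule inj_onI, rule ccontr)
    fix x y assume xy: "x \<in> F" "y \<in> F" "K #> x = K #> y" "x \<noteq> y"
    then have "x \<otimes> inv y \<in> K"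
      using rcos_eq_iff[OF sK, of x y] F(1) by blast
    moreover have "x \<otimes> inv y \<in> D"
      using xy by (auto simp: D_def)
    ultimately show False
      using K(3) by blast
  qed
  then have "Suc m = card ((\<lambda>x. K #> x) ` F)"
    using F(3) by (simp add: card_image)
  also have "\<dots> \<le> card (rcosets K)"
    using F(1) by (intro card_mono open_subgroup_finite_index[OF sK K(2)]) (auto simp: rcosets_eq_image)
  finally show ?thesis
    using that[OF K(1,2)] by simp
qed

end

section \<open>Normal subgroups of just infinite groups\<close>

context just_infinite_profinite_group
begin

lemma one_not_open: "\<not> openin T {\<one>}"
proof
  assume "openin T {\<one>}"
  then have "finite ((\<lambda>x. {\<one>} #> x) ` carrier G)"
    using open_subgroup_finite_index[OF triv_subgroup] by (simp add: rcosets_eq_image)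
  moreover have "inj_on (\<lambda>x. {\<one>} #> x) (carrier G)"
    by (rule inj_onI) (auto simp: r_coset_def)
  ultimately show False
    using infinite_carrier finite_imageD by blast
qed

lemma closed_normal_open:
  assumes "N \<lhd> G" "closedin T N" "N \<noteq> {\<one>}"
  shows "openin T N"
  using assms just_infinite closed_finite_index_open normal_imp_subgroup by blast

text \<open>The intersection of the sequence has infinitely many subgroups above it, so it has infinite
  index and is trivial; by compactness the sequence then enters every neighbourhood of the
  identity.\<close>

lemma strictly_decreasing_closed_normal:
  fixes N :: "nat \<Rightarrow> 'a set"
  assumes N: "\<And>i. N i \<lhd> G" "\<And>i. closedin T (N i)" and dec: "\<And>i. N (Suc i) \<subset> N i"
    and V: "openin T V" "\<one> \<in> V"
  shows "\<exists>i. N i \<subseteq> V"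
proof (rule ccontr)
  assume *: "\<nexists>i. N i \<subseteq> V"
  define B where "B = (\<Inter>i. N i)"
  have less: "N j \<subset> N i" if "i < j" for i j
    using that by (induction rule: less_Suc_induct) (use dec in blast)+
  then have "inj N"
    by (intro linorder_injI) blast
  have "(\<Inter>i. N i - V) \<noteq> {}"
  proof (rule compact_space_imp_nest[OF compact])
    show "closedin T (N i - V)" for i
      using N(2) V(1) by (rule closedin_diff)
    show "N i - V \<noteq> {}" for i
      using * by blast
    show "decseq (\<lambda>i. N i - V)"
      using dec by (intro decseq_SucI) blast
  qed
  then have "B \<noteq> {\<one>}"
    using V(2) by (auto simp: B_def)
  moreover have "B \<lhd> G"
    unfolding B_def using N(1) by (intro normal_Inter) auto
  moreover have "closedin T B"
    unfolding B_def using N(2) by (intro closedin_Inter) auto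
  ultimately have "finite {U. subgroup U G \<and> B \<subseteq> U}"
    using just_infinite finite_supergroups normal_imp_subgroup by blast
  moreover have "range N \<subseteq> {U. subgroup U G \<and> B \<subseteq> U}"
    using N(1) normal_imp_subgroup by (auto simp: B_def)
  ultimately have "finite (range N)"
    using finite_subset by blast
  then show False
    using \<open>inj N\<close> finite_imageD infinite_UNIV_nat by blast
qed

lemma minimal_closed_normal:
  assumes V: "openin T V" "\<one> \<in> V" and ne: "\<A> \<noteq> {}"
    and A: "\<And>A. A \<in> \<A> \<Longrightarrow> A \<lhd> G \<and> closedin T A \<and> \<not> A \<subseteq> V"
  obtains A where "A \<in> \<A>" "\<And>B. B \<in> \<A> \<Longrightarrow> \<not> B \<subset> A"
proof -
  let ?r = "{(B, A). B \<in> \<A> \<and> A \<in> \<A> \<and> B \<subset> A}"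
  have "wf ?r"
  proof (rule ccontr)
    assume "\<not> wf ?r"
    then obtain f where f: "\<And>i. (f (Suc i), f i) \<in> ?r"
      unfolding wf_iff_no_infinite_down_chain by blast
    have fA: "f i \<in> \<A>" for i
      using f[of i] by simp
    have "\<exists>i. f i \<subseteq> V"
    proof (rule strictly_decreasing_closed_normal[OF _ _ _ V])
      show "f i \<lhd> G" "closedin T (f i)" for i
        using A[OF fA] by blast+
      show "f (Suc i) \<subset> f i" for i
        using f[of i] by simp
    qed
    then show False
      using A[OF fA] by blast
  qed
  obtain A where "A \<in> \<A>" and min: "\<And>B. (B, A) \<in> ?r \<Longrightarrow> B \<notin> \<A>"
    using that by (rule wfE_min'[OF \<open>wf ?r\<close> ne])
  show ?thesis
  proof (rule that[OF \<open>A \<in> \<A>\<close>])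
    show "\<not> B \<subset> A" if "B \<in> \<A>" for B
      using min[of B] that \<open>A \<in> \<A>\<close> by auto
  qed
qed

text \<open>The maximal elements among the open normal subgroups of the whole group that lie properly
  inside \<open>N\<close>.  The competitors \<open>L\<close> contain the open subgroup \<open>M\<close> and so are open too.\<close>

definition maximal_normal_below :: "'a set \<Rightarrow> 'a set set" where
  "maximal_normal_below N = {M. M \<lhd> G \<and> openin T M \<and> M \<subset> N \<and>
     (\<forall>L. L \<lhd> G \<longrightarrow> M \<subseteq> L \<longrightarrow> L \<subset> N \<longrightarrow> L = M)}"

lemma open_normal_below_maximal:
  assumes L: "L \<lhd> G" "openin T L" "L \<subset> N"
  obtains M where "M \<in> maximal_normal_below N" "L \<subseteq> M"
proof -
  let ?S = "{U. U \<lhd> G \<and> L \<subseteq> U \<and> U \<subset> N}"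
  have sL: "subgroup L G"
    using L(1) by (rule normal_imp_subgroup)
  have "finite ?S"
    by (rule finite_subset[OF _ finite_supergroups[OF sL open_subgroup_finite_index[OF sL L(2)]]])
      (auto simp: normal_imp_subgroup)
  moreover have "L \<in> ?S"
    using L by simp
  ultimately have "\<exists>M\<in>?S. L \<subseteq> M \<and> (\<forall>U\<in>?S. M \<subseteq> U \<longrightarrow> M = U)"
    by (rule finite_has_maximal2)
  then obtain M where M: "M \<in> ?S" "L \<subseteq> M" "\<forall>U\<in>?S. M \<subseteq> U \<longrightarrow> M = U"
    by (elim bexE conjE)
  have "openin T M"
    using M(1) by (intro open_supergroup[OF sL L(2)] normal_imp_subgroup) auto
  moreover have "K = M" if "K \<lhd> G" "M \<subseteq> K" "K \<subset> N" for K
    using M(3) M(2) that by (metis (mono_tags) mem_Collect_eq subset_trans)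
  ultimately have "M \<in> maximal_normal_below N"
    using M(1) by (simp add: maximal_normal_below_def)
  then show ?thesis
    using that M(2) by blast
qed

text \<open>If \<open>N\<close> has infinitely many maximal subgroups \<open>M\<close> of this kind, their intersection is
  trivial.  Take \<open>A\<close> minimal among the closed normal subgroups inside \<open>N\<close> but not inside a
  fixed \<open>M1\<close>.  Minimality and the modular law force \<open>A \<inter> M1\<close> into every \<open>M\<close>, so the open
  subgroup \<open>A \<inter> M1\<close> is trivial, which is absurd in an infinite compact group.\<close>

lemma finite_maximal_normal_below:
  assumes N: "N \<lhd> G" "openin T N"
  shows "finite (maximal_normal_below N)"
proof (rule ccontr)
  assume inf: "infinite (maximal_normal_below N)"
  define D where "D = \<Inter>(maximal_normal_below N)"
  have Mx: "M \<lhd> G" "openin T M" "M \<subset> N" "subgroup M G"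
    if "M \<in> maximal_normal_below N" for M
    using that normal_imp_subgroup by (auto simp: maximal_normal_below_def)
  have Mmax: "L = M" if "M \<in> maximal_normal_below N" "L \<lhd> G" "M \<subseteq> L" "L \<subset> N" for L M
    using that by (auto simp: maximal_normal_below_def)
  obtain M1 where M1: "M1 \<in> maximal_normal_below N"
    using inf by (metis ex_in_conv finite.emptyI)
  have "D = {\<one>}"
  proof (rule ccontr)
    assume "D \<noteq> {\<one>}"
    moreover have "D \<lhd> G"
      unfolding D_def using M1 Mx(1) by (intro normal_Inter) auto
    moreover have "closedin T D"
      unfolding D_def using M1 Mx(2,4) open_subgroup_closed by (intro closedin_Inter) auto
    ultimately have "finite {U. subgroup U G \<and> D \<subseteq> U}"
      using just_infinite finite_supergroups normal_imp_subgroup by blast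
    moreover have "maximal_normal_below N \<subseteq> {U. subgroup U G \<and> D \<subseteq> U}"
      using Mx(4) by (auto simp: D_def)
    ultimately show False
      using inf finite_subset by blast
  qed
  let ?A = "{A. A \<lhd> G \<and> closedin T A \<and> A \<subseteq> N \<and> \<not> A \<subseteq> M1}"
  have "N \<in> ?A"
    using N Mx(3)[OF M1] open_subgroup_closed normal_imp_subgroup by auto
  then have "?A \<noteq> {}"
    by blast
  have "\<one> \<in> M1"
    using Mx(4)[OF M1] by (rule subgroup.one_closed)
  obtain A where A: "A \<in> ?A" and Amin: "\<And>B. B \<in> ?A \<Longrightarrow> \<not> B \<subset> A"
    by (rule minimal_closed_normal[OF Mx(2)[OF M1] \<open>\<one> \<in> M1\<close> \<open>?A \<noteq> {}\<close>]) auto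
  then have An: "A \<lhd> G" "closedin T A" "A \<subseteq> N" "\<not> A \<subseteq> M1" and sA: "subgroup A G"
    using normal_imp_subgroup by auto
  have AM1: "A \<inter> M1 \<lhd> G"
    using An(1) Mx(1)[OF M1] by (rule normal_subgroup_intersect)
  have sAM1: "subgroup (A \<inter> M1) G"
    using AM1 by (rule normal_imp_subgroup)
  have below: "A \<inter> M1 \<subseteq> M" if M: "M \<in> maximal_normal_below N" for M
  proof (rule ccontr)
    assume nsub: "\<not> A \<inter> M1 \<subseteq> M"
    have sM: "subgroup M G"
      using Mx(4)[OF M] .
    let ?P = "(A \<inter> M1) <#> M"
    have P: "?P \<lhd> G"
      using AM1 Mx(1)[OF M] by (rule normal_subgroup_set_mult_closed)
    have "M \<subseteq> ?P"
    proof
      fix m assume "m \<in> M"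
      then have "m = \<one> \<otimes> m" "\<one> \<in> A \<inter> M1"
        using sM sAM1 subgroup.mem_carrier subgroup.one_closed by force+
      then show "m \<in> ?P"
        using \<open>m \<in> M\<close> unfolding set_mult_def by blast
    qed
    have "?P \<subseteq> N"
      using An(3) Mx(3)[OF M] subgroup.m_closed[OF normal_imp_subgroup[OF N(1)]]
      by (auto simp: set_mult_def)
    have "A \<inter> M1 \<subseteq> ?P"
    proof
      fix a assume "a \<in> A \<inter> M1"
      then have "a = a \<otimes> \<one>" "\<one> \<in> M"
        using sM sAM1 subgroup.mem_carrier subgroup.one_closed by force+
      then show "a \<in> ?P"
        using \<open>a \<in> A \<inter> M1\<close> unfolding set_mult_def by blast
    qed
    then have "?P \<noteq> M"
      using nsub by blast
    then have "?P = N"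
      using Mmax[OF M P \<open>M \<subseteq> ?P\<close>] \<open>?P \<subseteq> N\<close> by blast
    \<comment> \<open>Since \<open>N\<close> is the product of \<open>A \<inter> M1\<close> and \<open>M\<close>, the modular law makes \<open>A\<close> the product of
      \<open>A \<inter> M1\<close> and \<open>A \<inter> M\<close>.  By minimality of \<open>A\<close> the second factor lies in \<open>M1\<close> as well.\<close>
    have "A \<inter> M \<lhd> G"
      using An(1) Mx(1)[OF M] by (rule normal_subgroup_intersect)
    moreover have "closedin T (A \<inter> M)"
      using An(2) open_subgroup_closed[OF sM Mx(2)[OF M]] by (rule closedin_Int)
    moreover have "A \<inter> M \<subset> A"
      using nsub by blast
    ultimately have "A \<inter> M \<subseteq> M1"
      using Amin[of "A \<inter> M"] An(3) by blast
    have "A \<subseteq> M1"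
    proof
      fix a assume a: "a \<in> A"
      then obtain b m where bm: "b \<in> A" "b \<in> M1" "m \<in> M" "a = b \<otimes> m"
        using An(3) \<open>?P = N\<close> unfolding set_mult_def by blast
      then have "m = inv b \<otimes> a"
        using subgroup.mem_carrier[OF sA] subgroup.mem_carrier[OF sM] by (simp add: inv_solve_left)
      then have "m \<in> A"
        using a bm(1) sA subgroup.m_closed subgroup.m_inv_closed by metis
      then have "m \<in> M1"
        using bm(3) \<open>A \<inter> M \<subseteq> M1\<close> by blast
      then show "a \<in> M1"
        using bm(2,4) subgroup.m_closed[OF Mx(4)[OF M1]] by blast
    qed
    then show False
      using An(4) by blast
  qed
  have "A \<inter> M1 \<subseteq> {\<one>}"
    using below \<open>D = {\<one>}\<close> by (auto simp: D_def)
  then have "A \<inter> M1 = {\<one>}"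
    using subgroup.one_closed[OF sAM1] by blast
  moreover have "openin T A"
    using An \<open>\<one> \<in> M1\<close> by (intro closed_normal_open) auto
  ultimately have "openin T {\<one>}"
    using Mx(2)[OF M1] openin_Int by metis
  then show False
    using one_not_open by blast
qed

theorem finite_open_normal_not_in_neighbourhood:
  assumes V: "openin T V" "\<one> \<in> V"
  shows "finite {N. N \<lhd> G \<and> openin T N \<and> \<not> N \<subseteq> V}"
proof (rule ccontr)
  \<comment> \<open>\<open>N\<close> is chosen below as a minimal open normal subgroup with \<open>E N\<close> infinite.\<close>
  define E where "E N = {L. L \<lhd> G \<and> openin T L \<and> L \<subseteq> N \<and> \<not> L \<subseteq> V}" for N
  assume "infinite {N. N \<lhd> G \<and> openin T N \<and> \<not> N \<subseteq> V}"
  moreover have "{N. N \<lhd> G \<and> openin T N \<and> \<not> N \<subseteq> V} = E (carrier G)"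
    using openin_subset by (auto simp: E_def topspace_eq[symmetric])
  ultimately have inf: "infinite (E (carrier G))"
    by simp
  let ?B = "{N. N \<lhd> G \<and> openin T N \<and> infinite (E N)}"
  have clo: "closedin T N" if "N \<lhd> G" "openin T N" for N
    using that open_subgroup_closed normal_imp_subgroup by blast
  have ne: "E N = {}" if "N \<subseteq> V" for N
    using that by (auto simp: E_def)
  have "carrier G \<lhd> G"
    by (rule normal_invI) (auto simp: subgroup_self)
  then have "carrier G \<in> ?B"
    using inf topspace_eq openin_topspace by (metis (mono_tags) mem_Collect_eq)
  then have "?B \<noteq> {}"
    by blast
  obtain N where N: "N \<in> ?B" and min: "\<And>M. M \<in> ?B \<Longrightarrow> \<not> M \<subset> N"
    by (rule minimal_closed_normal[OF V \<open>?B \<noteq> {}\<close>]) (use clo ne in auto)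
  have "E N \<subseteq> {N} \<union> (\<Union>M\<in>maximal_normal_below N. E M)"
  proof
    fix L assume L: "L \<in> E N"
    show "L \<in> {N} \<union> (\<Union>M\<in>maximal_normal_below N. E M)"
    proof (cases "L = N")
      case False
      then have "L \<lhd> G" "openin T L" "L \<subset> N"
        using L by (auto simp: E_def)
      then obtain M where "M \<in> maximal_normal_below N" "L \<subseteq> M"
        by (rule open_normal_below_maximal)
      then show ?thesis
        using L by (auto simp: E_def)
    qed simp
  qed
  moreover have "finite (E M)" if "M \<in> maximal_normal_below N" for M
    using that min[of M] by (auto simp: maximal_normal_below_def)
  then have "finite ({N} \<union> (\<Union>M\<in>maximal_normal_below N. E M))"
    using finite_maximal_normal_below[of N] N by simp
  ultimately show False
    using N finite_subset by blast
qed

lemma finite_open_normal_bounded_index: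
  "finite {N. N \<lhd> G \<and> openin T N \<and> card (rcosets N) \<le> m}"
proof -
  obtain K where K: "K \<lhd> G" "openin T K" "m < card (rcosets K)"
    by (rule infinite_imp_large_index[OF infinite_carrier])
  have "\<one> \<in> K"
    using K(1) normal_imp_subgroup subgroup.one_closed by blast
  from finite_open_normal_not_in_neighbourhood[OF K(2) this] show ?thesis
  proof (rule finite_subset[rotated], intro subsetI)
    fix N assume N: "N \<in> {N. N \<lhd> G \<and> openin T N \<and> card (rcosets N) \<le> m}"
    then have sN: "subgroup N G"
      using normal_imp_subgroup by blast
    have "\<not> N \<subseteq> K"
    proof
      assume "N \<subseteq> K"
      then have "card (rcosets K) \<le> card (rcosets N)"
        using finite_rcosets_mono[OF sN normal_imp_subgroup[OF K(1)]]
          open_subgroup_finite_index[OF sN] N by blast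
      then show False
        using K(3) N by auto
    qed
    then show "N \<in> {N. N \<lhd> G \<and> openin T N \<and> \<not> N \<subseteq> K}"
      using N by blast
  qed
qed

theorem finite_open_subgroups_of_index:
  "finite {U. subgroup U G \<and> openin T U \<and> card (rcosets U) = n}"
proof -
  let ?\<N> = "{N. N \<lhd> G \<and> openin T N \<and> card (rcosets N) \<le> n ^ n}"
  have "{U. subgroup U G \<and> openin T U \<and> card (rcosets U) = n} \<subseteq>
      (\<Union>N\<in>?\<N>. {U. subgroup U G \<and> N \<subseteq> U})"
  proof
    fix U assume "U \<in> {U. subgroup U G \<and> openin T U \<and> card (rcosets U) = n}"
    then have U: "subgroup U G" "openin T U" "card (rcosets U) = n"
      by auto
    have "core U \<in> ?\<N>"
      using core_normal[OF U(1)] open_core[OF U(1,2)]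
        card_rcosets_core[OF U(1) open_subgroup_finite_index[OF U(1,2)]] U(3) by simp
    then show "U \<in> (\<Union>N\<in>?\<N>. {U. subgroup U G \<and> N \<subseteq> U})"
      using U(1) core_subset by blast
  qed
  moreover have "finite (\<Union>N\<in>?\<N>. {U. subgroup U G \<and> N \<subseteq> U})"
  proof (intro finite_UN_I finite_open_normal_bounded_index)
    fix N assume "N \<in> ?\<N>"
    then show "finite {U. subgroup U G \<and> N \<subseteq> U}"
      using finite_supergroups open_subgroup_finite_index normal_imp_subgroup by blast
  qed
  ultimately show ?thesis
    by (rule finite_subset)
qed

end

section \<open>Lifting epimorphisms from finite quotients\<close>

lemma finite_functions_factoring:
  assumes "finite (q ` A)" "finite B"
  shows "finite {g \<in> A \<rightarrow>\<^sub>E B. \<forall>x\<in>A. \<forall>y\<in>A. q x = q y \<longrightarrow> g x = g y}"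
proof (rule finite_subset)
  show "{g \<in> A \<rightarrow>\<^sub>E B. \<forall>x\<in>A. \<forall>y\<in>A. q x = q y \<longrightarrow> g x = g y} \<subseteq>
      (\<lambda>p. \<lambda>x\<in>A. p (q x)) ` (q ` A \<rightarrow>\<^sub>E B)"
  proof
    fix g assume "g \<in> {g \<in> A \<rightarrow>\<^sub>E B. \<forall>x\<in>A. \<forall>y\<in>A. q x = q y \<longrightarrow> g x = g y}"
    then have g: "g \<in> A \<rightarrow>\<^sub>E B" and eq: "\<forall>x\<in>A. \<forall>y\<in>A. q x = q y \<longrightarrow> g x = g y"
      by blast+
    define p where "p = (\<lambda>c\<in>q ` A. g (inv_into A q c))"
    have "g x = p (q x)" if x: "x \<in> A" for x
    proof -
      have "inv_into A q (q x) \<in> A" "q (inv_into A q (q x)) = q x"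
        using x by (simp_all add: inv_into_into f_inv_into_f)
      then have "g (inv_into A q (q x)) = g x"
        using eq x by blast
      then show ?thesis
        using x by (simp add: p_def)
    qed
    then have "g = (\<lambda>x\<in>A. p (q x))"
      using g by (intro extensionalityI[of g A]) (auto simp: PiE_def)
    moreover have "p \<in> q ` A \<rightarrow>\<^sub>E B"
      unfolding p_def using PiE_mem[OF g] by (auto simp: inv_into_into)
    ultimately show "g \<in> (\<lambda>p. \<lambda>x\<in>A. p (q x)) ` (q ` A \<rightarrow>\<^sub>E B)"
      by blast
  qed
  show "finite ((\<lambda>p. \<lambda>x\<in>A. p (q x)) ` (q ` A \<rightarrow>\<^sub>E B))"
    using assms by (simp add: finite_PiE)
qed

text \<open>The hypotheses on \<open>H\<close>: an infinite profinite group all of whose finite continuous images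
  are images of the just infinite group \<open>G\<close>.\<close>

locale finite_images_of_just_infinite =
  G: just_infinite_profinite_group G T + H: profinite_group H S
  for G :: "('a, 'm) monoid_scheme" and T :: "'a topology"
    and H :: "('b, 'n) monoid_scheme" and S :: "'b topology" +
  assumes infinite_H: "infinite (carrier H)"
    and finite_image: "\<And>N. \<lbrakk>N \<lhd> H; closedin S N; finite (carrier (H Mod N))\<rbrakk> \<Longrightarrow>
      \<exists>M. M \<lhd> G \<and> closedin T M \<and>
        topologically_isomorphic (H Mod N) (quotient_topology H S N)
          (G Mod M) (quotient_topology G T M)"
begin

text \<open>The continuous epimorphisms from \<open>G\<close> onto \<open>H Mod N\<close>; for open \<open>N\<close> the quotient is
  discrete, so continuity means that all fibres are open.\<close>

definition epis :: "'b set \<Rightarrow> ('a \<Rightarrow> 'b set) set" where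
  "epis N = {\<phi>. \<phi> \<in> hom G (H Mod N) \<and> \<phi> ` carrier G = carrier (H Mod N) \<and>
     (\<forall>c\<in>carrier (H Mod N). openin T {x \<in> carrier G. \<phi> x = c})}"

text \<open>The maps from \<open>G\<close> to \<open>H\<close>, not necessarily homomorphisms, that induce a continuous
  epimorphism modulo \<open>N\<close>.\<close>

definition lifts :: "'b set \<Rightarrow> ('a \<Rightarrow> 'b) set" where
  "lifts N = {f \<in> carrier G \<rightarrow>\<^sub>E carrier H. (\<lambda>x\<in>carrier G. N #>\<^bsub>H\<^esub> f x) \<in> epis N}"

lemma carrier_Mod: "carrier (H Mod N) = rcosets\<^bsub>H\<^esub> N"
  by (simp add: FactGroup_def)

lemma epis_cong:
  assumes "\<phi> \<in> epis N" "\<And>x. x \<in> carrier G \<Longrightarrow> \<psi> x = \<phi> x"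
  shows "\<psi> \<in> epis N"
proof -
  have "\<psi> \<in> hom G (H Mod N)"
    using assms by (auto simp: epis_def hom_def)
  moreover have "\<psi> ` carrier G = \<phi> ` carrier G"
    using assms(2) by (intro image_cong) auto
  moreover have "{x \<in> carrier G. \<psi> x = c} = {x \<in> carrier G. \<phi> x = c}" for c
    using assms(2) by auto
  ultimately show ?thesis
    using assms(1) by (simp add: epis_def)
qed

lemma lifts_iff:
  assumes "N \<lhd> H"
  shows "f \<in> lifts N \<longleftrightarrow> f \<in> carrier G \<rightarrow>\<^sub>E carrier H \<and>
    (\<forall>x\<in>carrier G. \<forall>y\<in>carrier G. N #>\<^bsub>H\<^esub> f (x \<otimes>\<^bsub>G\<^esub> y) = N #>\<^bsub>H\<^esub> (f x \<otimes>\<^bsub>H\<^esub> f y)) \<and>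
    (\<forall>h\<in>carrier H. \<exists>x\<in>carrier G. N #>\<^bsub>H\<^esub> f x = N #>\<^bsub>H\<^esub> h) \<and>
    (\<forall>h\<in>carrier H. openin T {x \<in> carrier G. N #>\<^bsub>H\<^esub> f x = N #>\<^bsub>H\<^esub> h})"
proof (cases "f \<in> carrier G \<rightarrow>\<^sub>E carrier H")
  case True
  let ?\<phi> = "\<lambda>x\<in>carrier G. N #>\<^bsub>H\<^esub> f x"
  have f: "f x \<in> carrier H" if "x \<in> carrier G" for x
    using True that by (rule PiE_mem)
  have sum: "(N #>\<^bsub>H\<^esub> f x) <#>\<^bsub>H\<^esub> (N #>\<^bsub>H\<^esub> f y) = N #>\<^bsub>H\<^esub> (f x \<otimes>\<^bsub>H\<^esub> f y)"
    if "x \<in> carrier G" "y \<in> carrier G" for x y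
    using normal.rcos_sum[OF assms] f that by blast
  have "?\<phi> \<in> hom G (H Mod N) \<longleftrightarrow>
      (\<forall>x\<in>carrier G. \<forall>y\<in>carrier G. N #>\<^bsub>H\<^esub> f (x \<otimes>\<^bsub>G\<^esub> y) = N #>\<^bsub>H\<^esub> (f x \<otimes>\<^bsub>H\<^esub> f y))"
    using f by (auto simp: hom_def sum carrier_FactGroup)
  moreover have "?\<phi> ` carrier G = carrier (H Mod N) \<longleftrightarrow>
      (\<forall>h\<in>carrier H. \<exists>x\<in>carrier G. N #>\<^bsub>H\<^esub> f x = N #>\<^bsub>H\<^esub> h)"
  proof -
    have "?\<phi> ` carrier G \<subseteq> carrier (H Mod N)"
      using f by (auto simp: carrier_FactGroup)
    then have "?\<phi> ` carrier G = carrier (H Mod N) \<longleftrightarrow> carrier (H Mod N) \<subseteq> ?\<phi> ` carrier G"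
      by blast
    also have "\<dots> \<longleftrightarrow> (\<forall>h\<in>carrier H. \<exists>x\<in>carrier G. N #>\<^bsub>H\<^esub> h = N #>\<^bsub>H\<^esub> f x)"
      by (auto simp: carrier_FactGroup image_iff)
    finally show ?thesis
      by (simp add: eq_commute)
  qed
  moreover have "{x \<in> carrier G. ?\<phi> x = c} = {x \<in> carrier G. N #>\<^bsub>H\<^esub> f x = c}" for c
    by auto
  ultimately show ?thesis
    using True by (simp add: lifts_def epis_def carrier_FactGroup)
qed (simp add: lifts_def)

lemma lifts_antimono:
  assumes "N \<lhd> H" "N' \<lhd> H" "N \<subseteq> N'"
  shows "lifts N \<subseteq> lifts N'"
proof
  fix f assume "f \<in> lifts N"
  then have f: "f \<in> carrier G \<rightarrow>\<^sub>E carrier H"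
    and mult: "\<And>x y. \<lbrakk>x \<in> carrier G; y \<in> carrier G\<rbrakk> \<Longrightarrow>
        N #>\<^bsub>H\<^esub> f (x \<otimes>\<^bsub>G\<^esub> y) = N #>\<^bsub>H\<^esub> (f x \<otimes>\<^bsub>H\<^esub> f y)"
    and onto: "\<And>h. h \<in> carrier H \<Longrightarrow> \<exists>x\<in>carrier G. N #>\<^bsub>H\<^esub> f x = N #>\<^bsub>H\<^esub> h"
    and op: "\<And>h. h \<in> carrier H \<Longrightarrow> openin T {x \<in> carrier G. N #>\<^bsub>H\<^esub> f x = N #>\<^bsub>H\<^esub> h}"
    unfolding lifts_iff[OF assms(1)] by blast+
  have fH: "f x \<in> carrier H" if "x \<in> carrier G" for x
    using f that by (rule PiE_mem)
  have sub: "subgroup N H" "subgroup N' H"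
    using assms normal_imp_subgroup by blast+
  have coarser: "N' #>\<^bsub>H\<^esub> a = N' #>\<^bsub>H\<^esub> b"
    if "a \<in> carrier H" "b \<in> carrier H" "N #>\<^bsub>H\<^esub> a = N #>\<^bsub>H\<^esub> b" for a b
    using that assms(3) H.rcos_eq_iff[OF sub(1)] H.rcos_eq_iff[OF sub(2)] by blast
  show "f \<in> lifts N'"
    unfolding lifts_iff[OF assms(2)]
  proof (intro conjI ballI f)
    fix x y assume "x \<in> carrier G" "y \<in> carrier G"
    then show "N' #>\<^bsub>H\<^esub> f (x \<otimes>\<^bsub>G\<^esub> y) = N' #>\<^bsub>H\<^esub> (f x \<otimes>\<^bsub>H\<^esub> f y)"
      by (intro coarser mult) (auto intro: fH)
  next
    fix h assume h: "h \<in> carrier H"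
    then show "\<exists>x\<in>carrier G. N' #>\<^bsub>H\<^esub> f x = N' #>\<^bsub>H\<^esub> h"
      using onto[OF h] coarser fH by blast
    let ?K = "{k \<in> carrier H. N' #>\<^bsub>H\<^esub> k = N' #>\<^bsub>H\<^esub> h}"
    have "{x \<in> carrier G. N' #>\<^bsub>H\<^esub> f x = N' #>\<^bsub>H\<^esub> h} =
        (\<Union>k\<in>?K. {x \<in> carrier G. N #>\<^bsub>H\<^esub> f x = N #>\<^bsub>H\<^esub> k})" (is "?L = ?R")
    proof
      show "?L \<subseteq> ?R"
        using fH by blast
      show "?R \<subseteq> ?L"
      proof
        fix x assume "x \<in> ?R"
        then obtain k where "k \<in> carrier H" "N' #>\<^bsub>H\<^esub> k = N' #>\<^bsub>H\<^esub> h"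
            "x \<in> carrier G" "N #>\<^bsub>H\<^esub> f x = N #>\<^bsub>H\<^esub> k"
          by blast
        then show "x \<in> ?L"
          using coarser[of "f x" k] fH[of x] by simp
      qed
    qed
    moreover have "openin T ?R"
      using op by (intro openin_Union) auto
    ultimately show "openin T {x \<in> carrier G. N' #>\<^bsub>H\<^esub> f x = N' #>\<^bsub>H\<^esub> h}"
      by simp
  qed
qed

text \<open>The kernel of such an epimorphism is an open normal subgroup whose index is that of \<open>N\<close>,
  which is finite because \<open>N\<close> is open.  There are finitely many candidates, so all these epimorphisms factor through one
  finite quotient of \<open>G\<close>.\<close>

lemma finite_epis:
  assumes N: "N \<lhd> H" "openin S N"
  shows "finite (epis N \<inter> extensional (carrier G))"
proof (cases "epis N = {}")
  case False
  define m where "m = card (rcosets\<^bsub>H\<^esub> N)"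
  define \<K> where "\<K> = {K. K \<lhd> G \<and> openin T K \<and> card (rcosets\<^bsub>G\<^esub> K) \<le> m}"
  define D where "D = \<Inter>\<K>"
  have finN: "finite (carrier (H Mod N))"
    using H.open_subgroup_finite_index[OF normal_imp_subgroup[OF N(1)] N(2)]
    by (simp add: carrier_Mod)
  interpret HN: Group.group "H Mod N"
    using N(1) by (rule normal.factorgroup_is_group)
  have hom: "group_hom G (H Mod N) \<phi>" if "\<phi> \<in> epis N" for \<phi>
    using that by unfold_locales (simp add: epis_def)
  have same_iff: "\<phi> x = \<phi> y \<longleftrightarrow> x \<otimes>\<^bsub>G\<^esub> inv\<^bsub>G\<^esub> y \<in> kernel G (H Mod N) \<phi>"
    if "\<phi> \<in> epis N" "x \<in> carrier G" "y \<in> carrier G" for \<phi> x y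
  proof -
    interpret group_hom G "H Mod N" \<phi>
      using hom that(1) .
    have "\<phi> (x \<otimes>\<^bsub>G\<^esub> inv\<^bsub>G\<^esub> y) = \<phi> x \<otimes>\<^bsub>H Mod N\<^esub> inv\<^bsub>H Mod N\<^esub> \<phi> y"
      using that by simp
    moreover have "\<phi> x \<otimes>\<^bsub>H Mod N\<^esub> inv\<^bsub>H Mod N\<^esub> \<phi> y = \<one>\<^bsub>H Mod N\<^esub> \<longleftrightarrow> \<phi> x = \<phi> y"
      using HN.inv_solve_right'[of "\<one>\<^bsub>H Mod N\<^esub>" "\<phi> x" "\<phi> y"] that hom_closed HN.l_one HN.one_closed
      by metis
    ultimately show ?thesis
      using that by (simp add: kernel_def)
  qed
  have ker: "kernel G (H Mod N) \<phi> \<in> \<K>" if \<phi>: "\<phi> \<in> epis N" for \<phi>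
  proof -
    interpret group_hom G "H Mod N" \<phi>
      using hom \<phi> .
    have im: "\<phi> ` carrier G = carrier (H Mod N)"
      using \<phi> by (simp add: epis_def)
    have "openin T {x \<in> carrier G. \<phi> x = \<one>\<^bsub>H Mod N\<^esub>}"
      using \<phi> HN.one_closed unfolding epis_def by blast
    then have "openin T (kernel G (H Mod N) \<phi>)"
      by (simp add: kernel_def)
    moreover have "card (rcosets\<^bsub>G\<^esub> kernel G (H Mod N) \<phi>) \<le> m"
    proof -
      have fin: "finite (\<phi> ` carrier G)"
        using finN im by simp
      have "kernel G (H Mod N) \<phi> #>\<^bsub>G\<^esub> x = kernel G (H Mod N) \<phi> #>\<^bsub>G\<^esub> y"
        if "x \<in> carrier G" "y \<in> carrier G" "\<phi> x = \<phi> y" for x y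
        using that same_iff[OF \<phi>] G.rcos_eq_iff[OF subgroup_kernel] by simp
      from finite_image_if_determined[OF fin this] show ?thesis
        by (simp add: G.rcosets_eq_image im carrier_Mod m_def)
    qed
    ultimately show ?thesis
      using normal_kernel by (simp add: \<K>_def)
  qed
  have fin\<K>: "finite \<K>"
    unfolding \<K>_def by (rule G.finite_open_normal_bounded_index)
  have ne: "\<K> \<noteq> {}"
    using False ker by blast
  have "D \<lhd> G"
    unfolding D_def by (rule G.normal_Inter[OF ne]) (simp add: \<K>_def)
  then have sD: "subgroup D G"
    by (rule normal_imp_subgroup)
  moreover have "openin T D"
    unfolding D_def by (rule openin_Inter[OF fin\<K> ne]) (simp add: \<K>_def)
  ultimately have finD: "finite (rcosets\<^bsub>G\<^esub> D)"
    by (rule G.open_subgroup_finite_index)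
  have "\<phi> x = \<phi> y"
    if "\<phi> \<in> epis N" "x \<in> carrier G" "y \<in> carrier G" "D #>\<^bsub>G\<^esub> x = D #>\<^bsub>G\<^esub> y" for \<phi> x y
  proof -
    have "x \<otimes>\<^bsub>G\<^esub> inv\<^bsub>G\<^esub> y \<in> D"
      using that G.rcos_eq_iff[OF sD] by simp
    then have "x \<otimes>\<^bsub>G\<^esub> inv\<^bsub>G\<^esub> y \<in> kernel G (H Mod N) \<phi>"
      using ker[OF that(1)] by (auto simp: D_def)
    then show ?thesis
      using same_iff that by simp
  qed
  moreover have "\<phi> \<in> carrier G \<rightarrow>\<^sub>E carrier (H Mod N)"
    if "\<phi> \<in> epis N" "\<phi> \<in> extensional (carrier G)" for \<phi>
    using that by (auto simp: epis_def hom_def PiE_def)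
  ultimately have "epis N \<inter> extensional (carrier G) \<subseteq>
      {\<phi> \<in> carrier G \<rightarrow>\<^sub>E carrier (H Mod N).
        \<forall>x\<in>carrier G. \<forall>y\<in>carrier G. D #>\<^bsub>G\<^esub> x = D #>\<^bsub>G\<^esub> y \<longrightarrow> \<phi> x = \<phi> y}"
    by blast
  then show ?thesis
    by (rule finite_subset)
      (use finD finN in \<open>auto intro!: finite_functions_factoring simp: G.rcosets_eq_image\<close>)
qed simp

text \<open>Being a lift depends only on the cosets modulo \<open>N\<close> of the values, and by \<open>finite_epis\<close> only
  finitely many families of cosets occur; each of them is a closed condition.\<close>

lemma closedin_lifts:
  assumes N: "N \<lhd> H" "openin S N"
  shows "closedin (product_topology (\<lambda>_. S) (carrier G)) (lifts N)"
proof -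
  let ?P = "product_topology (\<lambda>_. S) (carrier G)"
  have sN: "subgroup N H"
    using N(1) by (rule normal_imp_subgroup)
  have "lifts N = (\<Union>\<phi>\<in>epis N \<inter> extensional (carrier G).
      \<Inter>x\<in>carrier G. {f \<in> topspace ?P. f x \<in> {h \<in> carrier H. N #>\<^bsub>H\<^esub> h = \<phi> x}})" (is "_ = ?R")
  proof
    show "lifts N \<subseteq> ?R"
    proof
      fix f assume f: "f \<in> lifts N"
      let ?\<phi> = "\<lambda>x\<in>carrier G. N #>\<^bsub>H\<^esub> f x"
      have "?\<phi> \<in> epis N \<inter> extensional (carrier G)"
        using f by (simp add: lifts_def)
      moreover have "f \<in> carrier G \<rightarrow>\<^sub>E carrier H"
        using f by (simp add: lifts_def)
      then have "f \<in> (\<Inter>x\<in>carrier G. {f \<in> topspace ?P. f x \<in> {h \<in> carrier H. N #>\<^bsub>H\<^esub> h = ?\<phi> x}})"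
        by (auto simp: H.topspace_eq)
      ultimately show "f \<in> ?R"
        by blast
    qed
    show "?R \<subseteq> lifts N"
    proof
      fix f assume "f \<in> ?R"
      then obtain \<phi> where \<phi>: "\<phi> \<in> epis N"
        and f: "\<And>x. x \<in> carrier G \<Longrightarrow> f \<in> topspace ?P \<and> N #>\<^bsub>H\<^esub> f x = \<phi> x"
        by blast
      have "f \<in> carrier G \<rightarrow>\<^sub>E carrier H"
        using f[OF G.one_closed] by (simp add: H.topspace_eq)
      moreover have "(\<lambda>x\<in>carrier G. N #>\<^bsub>H\<^esub> f x) \<in> epis N"
        by (rule epis_cong[OF \<phi>]) (simp add: f)
      ultimately show "f \<in> lifts N"
        by (simp add: lifts_def)
    qed
  qed
  moreover have "closedin ?P ?R"
  proof (rule closedin_Union)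
    show "finite ((\<lambda>\<phi>. \<Inter>x\<in>carrier G. {f \<in> topspace ?P. f x \<in> {h \<in> carrier H. N #>\<^bsub>H\<^esub> h = \<phi> x}}) `
        (epis N \<inter> extensional (carrier G)))"
      by (rule finite_imageI[OF finite_epis[OF N]])
    have "closedin ?P (\<Inter>x\<in>carrier G. {f \<in> topspace ?P. f x \<in> {h \<in> carrier H. N #>\<^bsub>H\<^esub> h = \<phi> x}})"
      if \<phi>: "\<phi> \<in> epis N" for \<phi>
    proof (rule closedin_INT)
      show "carrier G \<noteq> {}"
        using G.one_closed by blast
      fix x assume x: "x \<in> carrier G"
      then have "\<phi> x \<in> carrier (H Mod N)"
        using \<phi> by (auto simp: epis_def)
      then obtain k where k: "k \<in> carrier H" "\<phi> x = N #>\<^bsub>H\<^esub> k"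
        by (auto simp: carrier_FactGroup)
      have "closedin S {h \<in> carrier H. N #>\<^bsub>H\<^esub> h = \<phi> x}"
        using H.closedin_rcos[OF sN H.open_subgroup_closed[OF sN N(2)] k(1)] H.rcos_fibre[OF sN k(1)]
        by (simp add: k(2))
      then show "closedin ?P {f \<in> topspace ?P. f x \<in> {h \<in> carrier H. N #>\<^bsub>H\<^esub> h = \<phi> x}}"
        by (rule closedin_continuous_map_preimage[OF continuous_map_product_projection[OF x]])
    qed
    then show "closedin ?P Z"
      if "Z \<in> (\<lambda>\<phi>. \<Inter>x\<in>carrier G. {f \<in> topspace ?P. f x \<in> {h \<in> carrier H. N #>\<^bsub>H\<^esub> h = \<phi> x}}) `
        (epis N \<inter> extensional (carrier G))" for Z
      using that by blast
  qed
  ultimately show ?thesis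
    by simp
qed

lemma lifts_nonempty:
  assumes N: "N \<lhd> H" "openin S N"
  shows "lifts N \<noteq> {}"
proof -
  have sN: "subgroup N H"
    using N(1) by (rule normal_imp_subgroup)
  have finN: "finite (carrier (H Mod N))"
    using H.open_subgroup_finite_index[OF sN N(2)] by (simp add: carrier_Mod)
  obtain M g where M: "M \<lhd> G" "closedin T M" and g: "g \<in> iso (H Mod N) (G Mod M)"
    using finite_image[OF N(1) H.open_subgroup_closed[OF sN N(2)] finN]
    by (auto simp: topologically_isomorphic_def)
  have sM: "subgroup M G"
    using M(1) by (rule normal_imp_subgroup)
  interpret HN: Group.group "H Mod N"
    using N(1) by (rule normal.factorgroup_is_group)
  define \<psi> where "\<psi> = inv_into (carrier (H Mod N)) g"
  have bij: "bij_betw g (carrier (H Mod N)) (carrier (G Mod M))"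
    using g by (simp add: iso_def)
  have \<psi>: "\<psi> \<in> iso (G Mod M) (H Mod N)"
    unfolding \<psi>_def using g by (rule HN.iso_set_sym)
  have "finite (carrier (G Mod M))"
    using bij finN bij_betw_finite by blast
  then have "openin T M"
    by (intro G.closed_finite_index_open[OF sM M(2)]) (simp add: FactGroup_def)
  define \<phi> where "\<phi> x = \<psi> (M #>\<^bsub>G\<^esub> x)" for x
  have MG: "M #>\<^bsub>G\<^esub> x \<in> carrier (G Mod M)" if "x \<in> carrier G" for x
    using that by (simp add: carrier_FactGroup)
  have "\<phi> \<in> hom G (H Mod N)"
    using hom_compose[OF normal.r_coset_hom_Mod[OF M(1)], of \<psi> "H Mod N"] \<psi>
    by (simp add: \<phi>_def[abs_def] iso_def o_def)
  moreover have "\<phi> ` carrier G = carrier (H Mod N)"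
  proof -
    have "\<phi> ` carrier G = \<psi> ` carrier (G Mod M)"
      by (simp add: \<phi>_def[abs_def] carrier_FactGroup image_image)
    then show ?thesis
      using \<psi> by (simp add: iso_def bij_betw_def)
  qed
  moreover have "openin T {x \<in> carrier G. \<phi> x = c}" if c: "c \<in> carrier (H Mod N)" for c
  proof -
    have "g c \<in> carrier (G Mod M)"
      using bij c by (rule bij_betwE[THEN bspec])
    then obtain y where y: "y \<in> carrier G" "g c = M #>\<^bsub>G\<^esub> y"
      by (auto simp: carrier_FactGroup)
    have "\<phi> x = c \<longleftrightarrow> M #>\<^bsub>G\<^esub> x = M #>\<^bsub>G\<^esub> y" if "x \<in> carrier G" for x
    proof
      assume "\<phi> x = c"
      then show "M #>\<^bsub>G\<^esub> x = M #>\<^bsub>G\<^esub> y"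
        using bij_betw_inv_into_right[OF bij MG[OF that]] y(2) by (simp add: \<phi>_def \<psi>_def)
    next
      assume "M #>\<^bsub>G\<^esub> x = M #>\<^bsub>G\<^esub> y"
      then show "\<phi> x = c"
        using bij_betw_inv_into_left[OF bij c] y(2) by (simp add: \<phi>_def \<psi>_def)
    qed
    then have "{x \<in> carrier G. \<phi> x = c} = {x \<in> carrier G. M #>\<^bsub>G\<^esub> x = M #>\<^bsub>G\<^esub> y}"
      by blast
    also have "\<dots> = M #>\<^bsub>G\<^esub> y"
      by (rule G.rcos_fibre[OF sM y(1)])
    finally have "{x \<in> carrier G. \<phi> x = c} = M #>\<^bsub>G\<^esub> y" .
    then show ?thesis
      using G.openin_rcos[OF sM \<open>openin T M\<close> y(1)] by simp
  qed
  ultimately have "\<phi> \<in> epis N"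
    by (simp add: epis_def)
  have "\<exists>h. h \<in> carrier H \<and> N #>\<^bsub>H\<^esub> h = \<phi> x" if "x \<in> carrier G" for x
  proof -
    have "\<phi> x \<in> carrier (H Mod N)"
      using \<open>\<phi> ` carrier G = carrier (H Mod N)\<close> that by blast
    then show ?thesis
      by (auto simp: carrier_FactGroup)
  qed
  then obtain f where f: "\<And>x. x \<in> carrier G \<Longrightarrow> f x \<in> carrier H \<and> N #>\<^bsub>H\<^esub> f x = \<phi> x"
    by metis
  have "(\<lambda>x\<in>carrier G. N #>\<^bsub>H\<^esub> restrict f (carrier G) x) \<in> epis N"
    by (rule epis_cong[OF \<open>\<phi> \<in> epis N\<close>]) (simp add: f)
  then have "restrict f (carrier G) \<in> lifts N"
    using f by (simp add: lifts_def)
  then show ?thesis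
    by blast
qed

text \<open>The closed sets \<open>lifts N\<close> have the finite intersection property, since those of finitely many
  subgroups all contain that of their intersection; the product is compact by Tychonoff's
  theorem.\<close>

lemma common_lift:
  "\<exists>f. \<forall>N. N \<lhd> H \<longrightarrow> openin S N \<longrightarrow> f \<in> lifts N"
proof -
  let ?P = "product_topology (\<lambda>_. S) (carrier G)"
  let ?O = "{N. N \<lhd> H \<and> openin S N}"
  have "compact_space ?P"
    using H.compact by (simp add: compact_space_product_topology)
  moreover have "\<forall>C\<in>lifts ` ?O. closedin ?P C"
    using closedin_lifts by blast
  moreover have "\<Inter>\<F> \<noteq> {}" if fin: "finite \<F>" and sub: "\<F> \<subseteq> lifts ` ?O" for \<F>
  proof (cases "\<F> = {}")
    case False
    obtain \<N> where \<N>: "\<N> \<subseteq> ?O" "finite \<N>" "\<F> = lifts ` \<N>"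
      using finite_subset_image[OF fin sub] by blast
    then have ne: "\<N> \<noteq> {}"
      using False by blast
    have "\<Inter>\<N> \<lhd> H"
      using \<N>(1) by (intro H.normal_Inter[OF ne]) blast
    moreover have "openin S (\<Inter>\<N>)"
      using \<N>(1) by (intro openin_Inter[OF \<N>(2) ne]) blast
    ultimately have "lifts (\<Inter>\<N>) \<noteq> {}"
      by (rule lifts_nonempty)
    moreover have "lifts (\<Inter>\<N>) \<subseteq> lifts N" if "N \<in> \<N>" for N
      using that \<N>(1) \<open>\<Inter>\<N> \<lhd> H\<close> by (intro lifts_antimono) auto
    ultimately show ?thesis
      unfolding \<N>(3) by blast
  qed simp
  ultimately have "\<Inter>(lifts ` ?O) \<noteq> {}"
    unfolding compact_space_fip by blast
  then show ?thesis
    by blast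
qed

theorem topologically_isomorphic: "topologically_isomorphic G T H S"
proof -
  obtain f where f: "\<And>N. \<lbrakk>N \<lhd> H; openin S N\<rbrakk> \<Longrightarrow> f \<in> lifts N"
    using common_lift by blast
  have "carrier H \<lhd> H"
    by (rule H.normal_invI) (auto simp: H.subgroup_self)
  moreover have "openin S (carrier H)"
    using openin_topspace[of S] by (simp add: H.topspace_eq)
  ultimately have "f \<in> carrier G \<rightarrow>\<^sub>E carrier H"
    using f by (simp add: lifts_def)
  then have fH: "f x \<in> carrier H" if "x \<in> carrier G" for x
    using that by (rule PiE_mem)
  have mult: "f (x \<otimes>\<^bsub>G\<^esub> y) = f x \<otimes>\<^bsub>H\<^esub> f y" if x: "x \<in> carrier G" and y: "y \<in> carrier G" for x y
  proof (rule H.eq_if_congruent_mod_open_normal)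
    fix N assume N: "N \<lhd> H" "openin S N"
    then have "N #>\<^bsub>H\<^esub> f (x \<otimes>\<^bsub>G\<^esub> y) = N #>\<^bsub>H\<^esub> (f x \<otimes>\<^bsub>H\<^esub> f y)"
      using f[OF N] x y by (simp add: lifts_iff)
    then show "f (x \<otimes>\<^bsub>G\<^esub> y) \<otimes>\<^bsub>H\<^esub> inv\<^bsub>H\<^esub> (f x \<otimes>\<^bsub>H\<^esub> f y) \<in> N"
      using H.rcos_eq_iff[OF normal_imp_subgroup[OF N(1)]] fH x y by simp
  qed (use fH x y in auto)
  then interpret f: group_hom G H f
    using fH by unfold_locales (auto simp: hom_def)
  have cont: "continuous_map T S f"
    unfolding continuous_map_def
  proof (intro conjI allI impI)
    show "f \<in> topspace T \<rightarrow> topspace S"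
      using fH by (auto simp: G.topspace_eq H.topspace_eq)
    fix V assume V: "openin S V"
    show "openin T {x \<in> topspace T. f x \<in> V}"
    proof (subst openin_subopen, intro ballI)
      fix x assume "x \<in> {x \<in> topspace T. f x \<in> V}"
      then have x: "x \<in> carrier G" "f x \<in> V"
        by (simp_all add: G.topspace_eq)
      obtain N where N: "N \<lhd> H" "openin S N" "N #>\<^bsub>H\<^esub> f x \<subseteq> V"
        by (rule H.open_coset_in_neighbourhood[OF V x(2)])
      let ?W = "{y \<in> carrier G. N #>\<^bsub>H\<^esub> f y = N #>\<^bsub>H\<^esub> f x}"
      have "openin T ?W"
        using f[OF N(1,2)] fH[OF x(1)] by (simp add: lifts_iff[OF N(1)])
      moreover have "x \<in> ?W"
        using x(1) by simp
      moreover have "?W \<subseteq> {x \<in> topspace T. f x \<in> V}"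
      proof
        fix y assume y: "y \<in> ?W"
        then have "f y \<in> N #>\<^bsub>H\<^esub> f x"
          using H.rcos_self[OF fH normal_imp_subgroup[OF N(1)]] by blast
        then show "y \<in> {x \<in> topspace T. f x \<in> V}"
          using y N(3) by (auto simp: G.topspace_eq)
      qed
      ultimately show "\<exists>W. openin T W \<and> x \<in> W \<and> W \<subseteq> {x \<in> topspace T. f x \<in> V}"
        by blast
    qed
  qed
  have surj: "f ` carrier G = carrier H"
  proof (rule ccontr)
    assume "f ` carrier G \<noteq> carrier H"
    then obtain h where h: "h \<in> carrier H" "h \<notin> f ` carrier G"
      using fH by blast
    have "compactin S (f ` topspace T)"
      using G.compact cont image_compactin unfolding compact_space_def by blast
    then have "closedin S (f ` carrier G)"
      using H.Hausdorff compactin_imp_closedin by (simp add: G.topspace_eq)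
    then have "openin S (topspace S - f ` carrier G)"
      by blast
    moreover have "h \<in> topspace S - f ` carrier G"
      using h by (simp add: H.topspace_eq)
    ultimately obtain N where N: "N \<lhd> H" "openin S N" "N #>\<^bsub>H\<^esub> h \<subseteq> topspace S - f ` carrier G"
      by (rule H.open_coset_in_neighbourhood)
    obtain x where x: "x \<in> carrier G" "N #>\<^bsub>H\<^esub> f x = N #>\<^bsub>H\<^esub> h"
      using f[OF N(1,2)] h(1) unfolding lifts_iff[OF N(1)] by blast
    then have "f x \<in> N #>\<^bsub>H\<^esub> h"
      using H.rcos_self[OF fH[OF x(1)] normal_imp_subgroup[OF N(1)]] by simp
    then show False
      using N(3) x(1) by blast
  qed
  let ?K = "kernel G H f"
  have "?K = {\<one>\<^bsub>G\<^esub>}"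
  proof (rule ccontr)
    assume "?K \<noteq> {\<one>\<^bsub>G\<^esub>}"
    moreover have "closedin T ?K"
    proof -
      have "closedin S {\<one>\<^bsub>H\<^esub>}"
        using H.Hausdorff by (simp add: closedin_Hausdorff_singleton H.topspace_eq)
      from closedin_continuous_map_preimage[OF cont this] show ?thesis
        by (simp add: kernel_def G.topspace_eq)
    qed
    ultimately have "finite (rcosets\<^bsub>G\<^esub> ?K)"
      using G.just_infinite f.normal_kernel by blast
    then have fin: "finite ((\<lambda>x. ?K #>\<^bsub>G\<^esub> x) ` carrier G)"
      by (simp add: G.rcosets_eq_image)
    have "f x = f y" if "x \<in> carrier G" "y \<in> carrier G" "?K #>\<^bsub>G\<^esub> x = ?K #>\<^bsub>G\<^esub> y" for x y
    proof -
      have "f (x \<otimes>\<^bsub>G\<^esub> inv\<^bsub>G\<^esub> y) = \<one>\<^bsub>H\<^esub>"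
        using that G.rcos_eq_iff[OF f.subgroup_kernel] by (simp add: kernel_def)
      then have "f x \<otimes>\<^bsub>H\<^esub> inv\<^bsub>H\<^esub> f y = \<one>\<^bsub>H\<^esub>"
        using that by simp
      then show ?thesis
        using that fH H.inv_equality[of "f x" "inv\<^bsub>H\<^esub> f y"] by simp
    qed
    with fin have "finite (f ` carrier G) \<and> card (f ` carrier G) \<le> card ((\<lambda>x. ?K #>\<^bsub>G\<^esub> x) ` carrier G)"
      by (rule finite_image_if_determined)
    then have "finite (carrier H)"
      unfolding surj by (rule conjunct1)
    then show False
      using infinite_H by simp
  qed
  then have inj: "inj_on f (carrier G)"
    by (rule f.trivial_ker_imp_inj)
  have "f \<in> iso G H"
    using inj surj f.homh by (simp add: iso_def bij_betw_def)
  moreover have "homeomorphic_map T S f"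
    using cont G.compact H.Hausdorff surj inj
    by (intro continuous_imp_homeomorphic_map) (simp_all add: G.topspace_eq H.topspace_eq)
  ultimately show ?thesis
    unfolding topologically_isomorphic_def by blast
qed

end

section \<open>Finiteness of open subgroups and finite images\<close>

theorem corollary2p6:
  fixes G :: "('a, 'm) monoid_scheme" and T :: "'a topology"
    and H :: "('b, 'n) monoid_scheme" and S :: "'b topology"
  assumes "just_infinite_profinite_group G T"
  shows "(\<forall>n::int. finite {U. subgroup U G \<and> openin T U \<and> has_index G U n}) \<and>
    (profinite_group H S \<and> infinite (carrier H) \<and>
      (\<forall>N. N \<lhd> H \<and> closedin S N \<and> finite (carrier (H Mod N)) \<longrightarrow>
        (\<exists>M. M \<lhd> G \<and> closedin T M \<and>
          topologically_isomorphic (H Mod N) (quotient_topology H S N)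
            (G Mod M) (quotient_topology G T M)))
      \<longrightarrow> topologically_isomorphic G T H S)"
proof (intro conjI allI impI)
  interpret just_infinite_profinite_group G T
    using assms .
  fix n :: int
  have "{U. subgroup U G \<and> openin T U \<and> has_index G U n} \<subseteq>
      {U. subgroup U G \<and> openin T U \<and> card (rcosets\<^bsub>G\<^esub> U) = nat n}"
    by (auto simp: has_index_def)
  then show "finite {U. subgroup U G \<and> openin T U \<and> has_index G U n}"
    by (rule finite_subset) (rule finite_open_subgroups_of_index)
next
  assume H: "profinite_group H S \<and> infinite (carrier H) \<and>
      (\<forall>N. N \<lhd> H \<and> closedin S N \<and> finite (carrier (H Mod N)) \<longrightarrow>
        (\<exists>M. M \<lhd> G \<and> closedin T M \<and>
          topologically_isomorphic (H Mod N) (quotient_topology H S N)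
            (G Mod M) (quotient_topology G T M)))"
  have "finite_images_of_just_infinite G T H S"
    unfolding finite_images_of_just_infinite_def finite_images_of_just_infinite_axioms_def
    using assms H by blast
  then show "topologically_isomorphic G T H S"
    by (rule finite_images_of_just_infinite.topologically_isomorphic)
qed

end
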